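(* Let $n\in\mathbb{N}$ and $0<\lambda_0<1$. There exists a tidy collection $\mathfrak{F}$ of tangent balls in the open unit ball $\mathbb{B}_{n+1}\subset\mathbb{R}^{n+1}$ satisfying $|\mathfrak{F}|\cap\lambda_0\overline{\mathbb{B}}_{n+1}=\emptyset$ and having the following property: every path $\gamma\colon[0,1[\to\mathbb{B}_{n+1}$ such that $\lim_{t\to1}|\gamma(t)|=1$ and $\gamma([0,1[)\cap|\mathfrak{F}|=\emptyset$ has infinite length. In particular, every closed submanifold of $\mathbb{B}_{n+1}$ missing $|\mathfrak{F}|$ is complete.
   Context: $\mathbb{N}=\{1,2,\dots\}$; $\langle\cdot,\cdot\rangle$ and $|\cdot|$ are the Euclidean scalar product and norm in $\mathbb{R}^{n+1}$; $\mathbb{B}_{n+1}$ is the open unit ball centered at $0$; $tC=\{tp\colon p\in C\}$. Paths are continuous, and length means Euclidean length (possibly $+\infty$). A submanifold is complete if it is complete with the Riemannian metric induced by the Euclidean metric. For $p\in\mathbb{R}^{n+1}\setminus\{0\}$ let $\langle p\rangle^\perp=\{q\colon\langle q,p\rangle=0\}$. For such $p$ and $r>0$, the (closed) tangent ball of center $p$ and radius $r$ is $\overline{\mathscr{T}}(p,r):=p+(r\overline{\mathbb{B}}_{n+1}\cap\langle p\rangle^\perp)$. For a collection $\mathfrak{F}$ of tangent balls, $|\mathfrak{F}|:=\bigcup_{T\in\mathfrak{F}}T$. A collection $\mathfrak{F}$ of tangent balls contained in $\mathbb{B}_{n+1}$ is tidy if: - for all $0<t<1$, $t\overline{\mathbb{B}}_{n+1}$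 intersects only finitely many balls in $\mathfrak{F}$; - if $\overline{\mathscr{T}}(p_1,r_1),\overline{\mathscr{T}}(p_2,r_2)$ are distinct balls in $\mathfrak{F}$ with $|p_1|=|p_2|$, then $r_1=r_2$ and $\overline{\mathscr{T}}(p_1,r_1)\cap\overline{\mathscr{T}}(p_2,r_2)=\emptyset$; - if $\overline{\mathscr{T}}(p_1,r_1),\overline{\mathscr{T}}(p_2,r_2)\in\mathfrak{F}$ and $|p_1|<|p_2|$, then $\overline{\mathscr{T}}(p_1,r_1)\subset|p_2|\mathbb{B}_{n+1}$. *)

theory Defs
  imports "HOL-Analysis.Analysis"
begin

section \<open>Tangent balls and tidy collections\<close>

definition tangent_ball :: "'a::euclidean_space \<Rightarrow> real \<Rightarrow> 'a set" where
  "tangent_ball p r = (\<lambda>q. p + q) ` (cball 0 r \<inter> {q. q \<bullet> p = 0})"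

text \<open>
  A tangent ball is a set of points, and a collection is a set of such sets. The pairs \<open>(p, r)\<close>
  quantified below range over all admissible centres and radii presenting a member of the collection
  (in dimension at least 2 a tangent ball determines its centre and radius).
\<close>

definition tidy :: "'a::euclidean_space set set \<Rightarrow> bool" where
  "tidy F \<longleftrightarrow>
    (\<forall>T\<in>F. (\<exists>p r. p \<noteq> 0 \<and> r > 0 \<and> T = tangent_ball p r) \<and> T \<subseteq> ball 0 1) \<and>
    (\<forall>t. 0 < t \<and> t < 1 \<longrightarrow> finite {T\<in>F. T \<inter> cball 0 t \<noteq> {}}) \<and>
    (\<forall>p1 r1 p2 r2.
        p1 \<noteq> 0 \<and> r1 > 0 \<and> tangent_ball p1 r1 \<in> F \<and>
        p2 \<noteq> 0 \<and> r2 > 0 \<and> tangent_ball p2 r2 \<in> F \<longrightarrow>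
        (tangent_ball p1 r1 \<noteq> tangent_ball p2 r2 \<and> norm p1 = norm p2 \<longrightarrow>
          r1 = r2 \<and> tangent_ball p1 r1 \<inter> tangent_ball p2 r2 = {}) \<and>
        (norm p1 < norm p2 \<longrightarrow> tangent_ball p1 r1 \<subseteq> ball 0 (norm p2)))"


section \<open>Euclidean length of a path\<close>

text \<open>
  The supremum of the lengths of inscribed polygons; the parameter set \<open>I\<close> need not be compact,
  and the value may be \<open>\<infinity>\<close>.
\<close>

definition euclidean_length :: "real set \<Rightarrow> (real \<Rightarrow> 'a::euclidean_space) \<Rightarrow> ennreal" where
  "euclidean_length I \<gamma> =
    (SUP (m, s) \<in> {(m::nat, s). mono_on {..m} s \<and> s ` {..m} \<subseteq> I}.
      \<Sum>i<m. ennreal (dist (\<gamma> (s i)) (\<gamma> (s (Suc i)))))"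


section \<open>Submanifolds and completeness\<close>

definition C1_on :: "'a::euclidean_space set \<Rightarrow> ('a \<Rightarrow> 'b::euclidean_space) \<Rightarrow> bool" where
  "C1_on U f \<longleftrightarrow>
    (\<exists>f'. (\<forall>x\<in>U. (f has_derivative blinfun_apply (f' x)) (at x)) \<and> continuous_on U f')"

text \<open>
  Embedded \<open>k\<close>-dimensional submanifold without boundary of the open set \<open>W\<close>: around each of its points
  there is a diffeomorphism \<open>\<phi>\<close> between open sets, with inverse \<open>\<psi>\<close>, flattening \<open>M\<close> onto an open part of a
  \<open>k\<close>-dimensional linear subspace. Class \<open>C\<^sup>1\<close> is the weakest regularity for which the induced
  Riemannian metric makes sense; smooth submanifolds are in particular submanifolds in this sense.
  Connectedness is not required.
\<close>

definition submanifold_of :: "nat \<Rightarrow> 'a::euclidean_space set \<Rightarrow> 'a set \<Rightarrow> bool" where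
  "submanifold_of k W M \<longleftrightarrow> M \<subseteq> W \<and>
    (\<forall>p\<in>M. \<exists>(U::'a set) (V::'a set) \<phi> \<psi> S.
        p \<in> U \<and> U \<subseteq> W \<and> open U \<and> open V \<and>
        homeomorphism U V \<phi> \<psi> \<and> C1_on U \<phi> \<and> C1_on V \<psi> \<and>
        subspace S \<and> dim S = k \<and> \<phi> ` (U \<inter> M) = V \<inter> S)"

definition closed_submanifold_of :: "nat \<Rightarrow> 'a::euclidean_space set \<Rightarrow> 'a set \<Rightarrow> bool" where
  "closed_submanifold_of k W M \<longleftrightarrow> submanifold_of k W M \<and> closedin (top_of_set W) M"

text \<open>
  Length and distance for the Riemannian metric that the Euclidean scalar product induces on \<open>M\<close>.
  The finitely many parameters at which a piecewise \<open>C\<^sup>1\<close> path is not differentiable are a null set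
  for the integral. The distance of two points in different components of \<open>M\<close> is \<open>\<infinity>\<close>.
\<close>

definition riemannian_length :: "(real \<Rightarrow> 'a::euclidean_space) \<Rightarrow> ennreal" where
  "riemannian_length \<gamma> =
    (\<integral>\<^sup>+t\<in>{0..1}. ennreal (norm (vector_derivative \<gamma> (at t))) \<partial>lborel)"

definition riemannian_dist :: "'a::euclidean_space set \<Rightarrow> 'a \<Rightarrow> 'a \<Rightarrow> ennreal" where
  "riemannian_dist M x y =
    (INF \<gamma> \<in> {\<gamma>. \<gamma> piecewise_C1_differentiable_on {0..1} \<and> \<gamma> ` {0..1} \<subseteq> M \<and> \<gamma> 0 = x \<and> \<gamma> 1 = y}.
      riemannian_length \<gamma>)"

text \<open>
  Metric completeness for the Riemannian distance. As a Cauchy sequence eventually stays in one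
  component, this says that every connected component is a complete metric space.
\<close>

definition complete_submanifold :: "'a::euclidean_space set \<Rightarrow> bool" where
  "complete_submanifold M \<longleftrightarrow>
    (\<forall>\<sigma>::nat \<Rightarrow> 'a.
        range \<sigma> \<subseteq> M \<and>
        (\<forall>\<epsilon>>0. \<exists>N. \<forall>i j. N \<le> i \<longrightarrow> N \<le> j \<longrightarrow> riemannian_dist M (\<sigma> i) (\<sigma> j) < \<epsilon>) \<longrightarrow>
        (\<exists>x\<in>M. (\<lambda>i. riemannian_dist M (\<sigma> i) x) \<longlonglongrightarrow> 0))"

end

theory Submission
  imports Defs
begin

text \<open>
  Let \<open>p\<close> be the centre of a tangent ball of small radius \<open>r\<close>. A path that passes from below its layer to
  above it, and starts within \<open>r / 2\<close> of \<open>p\<close>, must move sideways by \<open>r / 2\<close> to avoid the ball, whereas the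
  layer has radial thickness of order \<open>r\<^sup>2\<close> only. Boundedly many layers suffice to put a centre close to
  every direction, so a shell of given thickness accommodates about \<open>1 / r\<^sup>2\<close> such detours. For \<open>r\<close> small
  enough, crossing the shell costs length at least 1, and the ball contains infinitely many disjoint
  shells. A Riemannian Cauchy sequence cannot approach the sphere for the same reason; its limit then
  lies in the submanifold, where a chart compares the two distances.
\<close>

section \<open>Tangent balls\<close>

lemma mem_tangent_ball:
  "x \<in> tangent_ball p r \<longleftrightarrow> norm (x - p) \<le> r \<and> (x - p) \<bullet> p = 0"
proof
  assume "norm (x - p) \<le> r \<and> (x - p) \<bullet> p = 0"
  then show "x \<in> tangent_ball p r"
    unfolding tangent_ball_def by (intro image_eqI[of _ _ "x - p"]) simp_all
qed (auto simp: tangent_ball_def)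

lemma norm_tangent:
  fixes x p :: "'a::real_inner"
  assumes "(x - p) \<bullet> p = 0"
  shows "(norm x)\<^sup>2 = (norm p)\<^sup>2 + (norm (x - p))\<^sup>2"
  using norm_add_Pythagorean[of "x - p" p] assms by (simp add: orthogonal_def)

lemma tangent_ball_norm_ge:
  assumes "x \<in> tangent_ball p r"
  shows "norm p \<le> norm x"
proof -
  have "(norm p)\<^sup>2 \<le> (norm x)\<^sup>2"
    using assms norm_tangent[of x p] by (simp add: mem_tangent_ball)
  then show ?thesis by (rule power2_le_imp_le) simp
qed

lemma tangent_ball_norm_le:
  assumes "x \<in> tangent_ball p r"
  shows "(norm x)\<^sup>2 \<le> (norm p)\<^sup>2 + r\<^sup>2"
  using assms norm_tangent[of x p] by (simp add: mem_tangent_ball power_mono)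

lemma tangent_ball_subset_ball:
  assumes "(norm p)\<^sup>2 + r\<^sup>2 < b\<^sup>2" "0 \<le> b"
  shows "tangent_ball p r \<subseteq> ball 0 b"
proof
  fix x assume "x \<in> tangent_ball p r"
  then have "(norm x)\<^sup>2 < b\<^sup>2" using tangent_ball_norm_le[of x p r] assms(1) by linarith
  then show "x \<in> ball 0 b" using power2_less_imp_less[OF _ assms(2)] by simp
qed

lemma tangent_ball_disjoint:
  assumes "2 * r < dist p q"
  shows "tangent_ball p r \<inter> tangent_ball q r = {}"
proof (rule ccontr)
  assume "tangent_ball p r \<inter> tangent_ball q r \<noteq> {}"
  then obtain x where "dist x p \<le> r" "dist x q \<le> r"
    by (auto simp: mem_tangent_ball dist_norm)
  with assms dist_triangle3[of p q x] show False by linarith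
qed

text \<open>The centre is the unique point of least norm; the radius is then read off the largest norm.\<close>

lemma tangent_ball_inject:
  fixes p q :: "'a::euclidean_space"
  assumes dim: "2 \<le> DIM('a)" and r: "0 < r" "0 < s"
    and eq: "tangent_ball p r = tangent_ball q s"
  shows "p = q \<and> r = s"
proof -
  have "p \<in> tangent_ball p r" "q \<in> tangent_ball q s" using r by (simp_all add: mem_tangent_ball)
  then have p: "p \<in> tangent_ball q s" and q: "q \<in> tangent_ball p r" by (simp_all only: eq)
  have "norm p = norm q"
    using tangent_ball_norm_ge[OF p] tangent_ball_norm_ge[OF q] by simp
  then have "p = q"
    using norm_tangent[of p q] p by (simp add: mem_tangent_ball)
  moreover obtain v where v: "v \<noteq> 0" "orthogonal p v"
    using orthogonal_to_vector_exists[OF dim] by blast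
  have le: "a \<le> b" if "tangent_ball p a \<subseteq> tangent_ball p b" "0 < a" for a b
  proof -
    \<comment> \<open>A tangent vector of length exactly \<open>a\<close>: since the dimension is at
      least 2, a direction orthogonal to \<open>p\<close> exists, and the ball really attains its
      radius.\<close>
    have "p + (a / norm v) *\<^sub>R v \<in> tangent_ball p a"
      using v that by (simp add: mem_tangent_ball orthogonal_def inner_commute)
    then have "p + (a / norm v) *\<^sub>R v \<in> tangent_ball p b" using that by blast
    then show ?thesis using v that by (simp add: mem_tangent_ball)
  qed
  moreover have "r \<le> s" "s \<le> r"
    using le[of r s] le[of s r] eq r \<open>p = q\<close> by simp_all
  ultimately show ?thesis by simp
qed

text \<open>
  A path crossing the two spheres either meets the hyperplane of the ball, and then outside the ball,
  or ends below the hyperplane, where every point beyond the outer sphere is far from the centre.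
\<close>

lemma evade_tangent_ball:
  fixes \<gamma> :: "real \<Rightarrow> 'a::euclidean_space"
  assumes uv: "u \<le> v" and cont: "continuous_on {u..v} \<gamma>"
    and start: "norm (\<gamma> u) \<le> norm c" and finish: "(norm c)\<^sup>2 + r\<^sup>2 \<le> (norm (\<gamma> v))\<^sup>2"
    and r: "0 \<le> r" and avoid: "\<gamma> ` {u..v} \<inter> tangent_ball c r = {}"
  shows "\<exists>t\<in>{u..v}. r \<le> dist (\<gamma> t) c"
proof (cases "c \<bullet> c \<le> \<gamma> v \<bullet> c")
  case True
  have "\<gamma> u \<bullet> c \<le> norm (\<gamma> u) * norm c" by (rule norm_cauchy_schwarz)
  also have "\<dots> \<le> norm c * norm c" using start by (simp add: mult_right_mono)
  finally have "\<gamma> u \<bullet> c \<le> c \<bullet> c" by (simp add: dot_square_norm power2_eq_square)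
  moreover have "continuous_on {u..v} (\<lambda>t. \<gamma> t \<bullet> c)"
    using cont by (intro continuous_intros)
  ultimately obtain t where t: "u \<le> t" "t \<le> v" "\<gamma> t \<bullet> c = c \<bullet> c"
    using IVT'[of "\<lambda>t. \<gamma> t \<bullet> c" u "c \<bullet> c" v] True uv by auto
  then have "\<gamma> t \<in> \<gamma> ` {u..v}" by simp
  then have "\<gamma> t \<notin> tangent_ball c r" using avoid by blast
  then have "r \<le> dist (\<gamma> t) c"
    using t by (simp add: mem_tangent_ball inner_diff_left dist_norm)
  then show ?thesis using t by auto
next
  case False
  \<comment> \<open>Below the hyperplane the cross term is less than twice
    \<open>(norm c)\<^sup>2\<close>, so the squared distance exceeds
    \<open>(norm (\<gamma> v))\<^sup>2 - (norm c)\<^sup>2\<close>, which is at least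
    \<open>r\<^sup>2\<close>.\<close>
  have "(dist (\<gamma> v) c)\<^sup>2 = (norm (\<gamma> v))\<^sup>2 - 2 * (\<gamma> v \<bullet> c) + (norm c)\<^sup>2"
    by (simp add: dist_norm power2_norm_eq_inner inner_diff_left inner_diff_right inner_commute)
  also have "\<dots> \<ge> r\<^sup>2"
    using False finish by (simp add: dot_square_norm)
  finally have "r \<le> dist (\<gamma> v) c" by (rule power2_le_imp_le) simp
  then show ?thesis using uv by auto
qed


section \<open>Coloured nets on the sphere\<close>

text \<open>
  One point is chosen in each cubical cell that meets the sphere, and cells are coloured by their
  integer coordinates modulo \<open>M\<close>. The number of colours does not depend on the mesh.
\<close>

lemma coloured_net:
  fixes C :: real
  shows "\<exists>m>0. \<forall>\<eta>>0. \<exists>P :: nat \<Rightarrow> 'a::euclidean_space set.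
    (\<forall>j. finite (P j) \<and> P j \<subseteq> sphere 0 1 \<and>
      (\<forall>p\<in>P j. \<forall>q\<in>P j. p \<noteq> q \<longrightarrow> C * \<eta> < dist p q)) \<and>
    (\<forall>u\<in>sphere 0 1. \<exists>j<m. \<exists>p\<in>P j. dist u p \<le> \<eta>)"
proof -
  define d where "d = real DIM('a)"
  have d: "0 < d" by (simp add: d_def)
  \<comment> \<open>Different cells of one colour differ by at least \<open>M\<close> in some
    integer coordinate. Undoing the floors loses less than 1, and the remaining \<open>M - 1\<close>
    must still exceed \<open>C * d\<close>.\<close>
  obtain M0 :: nat where M0: "C * d < real M0" using reals_Archimedean2[of "C * d"] by blast
  define M where "M = int M0 + 1"
  have M: "0 < M" "C * d < of_int M - 1" using M0 by (auto simp: M_def)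
  define K where "K = (\<Pi>\<^sub>E b\<in>(Basis::'a set). {0..<M})"
  have finK: "finite K" unfolding K_def by (intro finite_PiE) auto
  have "(\<lambda>b\<in>Basis. 0) \<in> K" unfolding K_def using M by auto
  then have "0 < card K" using finK by (auto simp: card_gt_0_iff)
  moreover have "\<exists>P :: nat \<Rightarrow> 'a set.
        (\<forall>j. finite (P j) \<and> P j \<subseteq> sphere 0 1 \<and>
          (\<forall>p\<in>P j. \<forall>q\<in>P j. p \<noteq> q \<longrightarrow> C * \<eta> < dist p q)) \<and>
        (\<forall>u\<in>sphere 0 1. \<exists>j<card K. \<exists>p\<in>P j. dist u p \<le> \<eta>)" if eta: "0 < \<eta>" for \<eta>
  proof -
    \<comment> \<open>The side of the cells: the norm is at most the sum of the \<open>d\<close>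
      coordinates in absolute value, so two points of one cell are at distance at most
      \<open>d * s\<close>, which is \<open>\<eta>\<close>.\<close>
    define s where "s = \<eta> / d"
    have s: "0 < s" using eta d by (simp add: s_def)
    define cell :: "'a \<Rightarrow> 'a \<Rightarrow> int" where "cell x = (\<lambda>b\<in>Basis. \<lfloor>(x \<bullet> b) / s\<rfloor>)" for x
    define colour :: "'a \<Rightarrow> 'a \<Rightarrow> int" where "colour x = (\<lambda>b\<in>Basis. cell x b mod M)" for x
    have colour: "colour x \<in> K" for x
      unfolding K_def colour_def using M by auto
    obtain h :: "nat \<Rightarrow> 'a \<Rightarrow> int" where h: "bij_betw h {..<card K} K"
      using ex_bij_betw_nat_finite[OF finK] by (auto simp: atLeast0LessThan)
    define Z where "Z = cell ` sphere 0 1"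
    define rep where "rep = inv_into (sphere (0::'a) 1) cell"
    have rep: "rep z \<in> sphere 0 1" "cell (rep z) = z" if "z \<in> Z" for z
      using that unfolding Z_def rep_def by (rule inv_into_into, rule f_inv_into_f)
    \<comment> \<open>Coordinates of unit vectors lie between -1 and 1, so only finitely many cells
      meet the sphere.\<close>
    have "Z \<subseteq> (\<Pi>\<^sub>E b\<in>(Basis::'a set). {\<lfloor>-1/s\<rfloor>..\<lfloor>1/s\<rfloor>})"
    proof
      fix z assume "z \<in> Z"
      then obtain x where x: "norm x = 1" "z = cell x" by (auto simp: Z_def)
      have "cell x b \<in> {\<lfloor>-1/s\<rfloor>..\<lfloor>1/s\<rfloor>}" if b: "b \<in> Basis" for b
      proof -
        have "-1 \<le> x \<bullet> b" "x \<bullet> b \<le> 1" using Basis_le_norm[OF b, of x] x by linarith+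
        then have "-1 / s \<le> (x \<bullet> b) / s" "(x \<bullet> b) / s \<le> 1 / s"
          using s by (simp_all add: divide_right_mono del: divide_minus_left)
        then show ?thesis
          using b by (simp only: cell_def restrict_apply if_True atLeastAtMost_iff floor_mono)
      qed
      then show "z \<in> (\<Pi>\<^sub>E b\<in>(Basis::'a set). {\<lfloor>-1/s\<rfloor>..\<lfloor>1/s\<rfloor>})"
        unfolding x(2) by (intro PiE_I) (simp_all add: cell_def)
    qed
    then have finZ: "finite Z" by (rule finite_subset) (intro finite_PiE, auto)
    \<comment> \<open>For \<open>j \<ge> card K\<close> the value \<open>h j\<close> is unspecified,
      but finiteness and separation hold whatever it is; covering uses only
      \<open>j < card K\<close>.\<close>
    define P where "P j = {p \<in> rep ` Z. colour p = h j}" for j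
    have "C * \<eta> < dist p q" if "p \<in> P j" "q \<in> P j" "p \<noteq> q" for j p q
    proof -
      have "cell p \<noteq> cell q" and col: "colour p = colour q"
        using that rep by (auto simp: P_def)
      then obtain b where b: "cell p b \<noteq> cell q b" by auto
      then have bB: "b \<in> Basis" by (auto simp: cell_def split: if_splits)
      have "cell p b mod M = cell q b mod M"
        using fun_cong[OF col, of b] bB by (simp add: colour_def)
      then have "M dvd cell p b - cell q b" by (simp add: mod_eq_dvd_iff)
      then have "M \<le> \<bar>cell p b - cell q b\<bar>"
        using b dvd_imp_le_int[of "cell p b - cell q b" M] M by simp
      then have "of_int M - 1 < \<bar>(p \<bullet> b) / s - (q \<bullet> b) / s\<bar>"
        using bB by (simp add: cell_def) linarith
      also have "\<dots> = \<bar>(p - q) \<bullet> b\<bar> / s"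
        using s by (simp add: inner_diff_left flip: diff_divide_distrib)
      also have "\<dots> \<le> dist p q / s"
        using Basis_le_norm[OF bB, of "p - q"] s by (simp add: dist_norm divide_right_mono)
      finally have "C * d < dist p q / s" using M by linarith
      then show ?thesis using s d by (simp add: s_def field_simps)
    qed
    moreover have "\<exists>j<card K. \<exists>p\<in>P j. dist u p \<le> \<eta>" if "u \<in> sphere 0 1" for u
    proof -
      define p where "p = rep (cell u)"
      have cu: "cell u \<in> Z" using that by (auto simp: Z_def)
      obtain j where "j < card K" "h j = colour p"
        using bij_betw_imp_surj_on[OF h] colour[of p] by (metis imageE lessThan_iff)
      moreover from this have "p \<in> P j" using cu by (auto simp: P_def p_def)
      moreover have "dist u p \<le> \<eta>"
      proof -
        have "\<bar>(u - p) \<bullet> b\<bar> \<le> s" if "b \<in> Basis" for b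
        proof -
          have "cell p b = cell u b" using rep[OF cu] by (simp add: p_def)
          then have "\<lfloor>(p \<bullet> b) / s\<rfloor> = \<lfloor>(u \<bullet> b) / s\<rfloor>" using that by (simp add: cell_def)
          then have "\<bar>(u \<bullet> b) / s - (p \<bullet> b) / s\<bar> \<le> 1" by linarith
          then show ?thesis using s by (simp add: inner_diff_left flip: diff_divide_distrib)
        qed
        then have "(\<Sum>b\<in>Basis. \<bar>(u - p) \<bullet> b\<bar>) \<le> (\<Sum>b\<in>(Basis::'a set). s)"
          by (rule sum_mono)
        also have "\<dots> = \<eta>" using d by (simp add: s_def d_def)
        finally show ?thesis using norm_le_l1[of "u - p"] by (simp add: dist_norm)
      qed
      ultimately show ?thesis by blast
    qed
    moreover have "finite (P j)" for j using finZ by (simp add: P_def)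
    moreover have "P j \<subseteq> sphere 0 1" for j using rep(1) by (auto simp only: P_def)
    ultimately show ?thesis by (intro exI[of _ P] conjI allI ballI impI)
  qed
  ultimately show ?thesis by (intro exI[of _ "card K"] conjI allI impI)
qed


section \<open>Crossing a shell\<close>

text \<open>
  \<open>L u v\<close> stands for the length of the part of \<open>\<gamma>\<close> between \<open>u\<close> and \<open>v\<close>. Both the polygonal length and
  the Riemannian length are of this kind.
\<close>

definition length_functional ::
  "real set \<Rightarrow> (real \<Rightarrow> 'a::metric_space) \<Rightarrow> (real \<Rightarrow> real \<Rightarrow> ennreal) \<Rightarrow> bool" where
  "length_functional I \<gamma> L \<longleftrightarrow>
    (\<forall>u\<in>I. \<forall>v\<in>I. u \<le> v \<longrightarrow> ennreal (dist (\<gamma> u) (\<gamma> v)) \<le> L u v) \<and>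
    (\<forall>u\<in>I. \<forall>v\<in>I. \<forall>w\<in>I. u \<le> v \<and> v \<le> w \<longrightarrow> L u v + L v w \<le> L u w)"

lemma length_functional_dist:
  assumes "length_functional I \<gamma> L" "u \<in> I" "v \<in> I" "u \<le> v"
  shows "ennreal (dist (\<gamma> u) (\<gamma> v)) \<le> L u v"
  using assms by (auto simp: length_functional_def)

lemma length_functional_add:
  assumes "length_functional I \<gamma> L" "u \<in> I" "v \<in> I" "w \<in> I" "u \<le> v" "v \<le> w"
  shows "L u v + L v w \<le> L u w"
  using assms by (auto simp: length_functional_def)

lemma length_functional_mono:
  assumes "length_functional I \<gamma> L" "u \<in> I" "v \<in> I" "w \<in> I" "u \<le> v" "v \<le> w"
  shows "L u v \<le> L u w"
  using length_functional_add[OF assms] by (rule order_trans[rotated]) simp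

lemma length_functional_subset:
  assumes "length_functional I \<gamma> L" "J \<subseteq> I"
  shows "length_functional J \<gamma> L"
  using assms unfolding length_functional_def by blast

text \<open>Cutting the path at a moment when its norm is \<open>B k\<close> splits off the last
  crossing, and superadditivity of \<open>L\<close> allows induction on \<open>k\<close>. The cost
  hypothesis speaks of all parameter subintervals so that the initial piece inherits it. It serves
  twice: for the blocks inside one shell and for the successive shells of the ball.\<close>

lemma level_crossing:
  fixes \<gamma> :: "real \<Rightarrow> 'a::real_normed_vector"
  assumes "length_functional {u..v} \<gamma> L" "u \<le> v" "continuous_on {u..v} \<gamma>"
    and "\<And>i. i < k \<Longrightarrow> B i \<le> B (Suc i)" and "0 \<le> \<delta>"
    and "\<And>i s t. i < k \<Longrightarrow> u \<le> s \<Longrightarrow> s \<le> t \<Longrightarrow> t \<le> v \<Longrightarrow> norm (\<gamma> s) \<le> B i \<Longrightarrow>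
        B (Suc i) \<le> norm (\<gamma> t) \<Longrightarrow> ennreal \<delta> \<le> L s t"
    and "norm (\<gamma> u) \<le> B 0" and "B k \<le> norm (\<gamma> v)"
  shows "ennreal (real k * \<delta>) \<le> L u v"
  using assms
proof (induction k arbitrary: v)
  case 0
  then show ?case by simp
next
  case (Suc k)
  have "j \<le> k \<Longrightarrow> B 0 \<le> B j" for j
    by (induction j) (use Suc.prems(4) in \<open>auto intro: order_trans\<close>)
  then have "B 0 \<le> B k" by simp
  moreover have "continuous_on {u..v} (\<lambda>t. norm (\<gamma> t))"
    using Suc.prems by (intro continuous_intros)
  ultimately obtain w where w: "u \<le> w" "w \<le> v" "norm (\<gamma> w) = B k"
    using IVT'[of "\<lambda>t. norm (\<gamma> t)" u "B k" v] Suc.prems by force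
  have "ennreal (real k * \<delta>) \<le> L u w"
  proof (rule Suc.IH)
    show "length_functional {u..w} \<gamma> L"
      using Suc.prems(1) by (rule length_functional_subset) (use w in auto)
    show "continuous_on {u..w} \<gamma>"
      using Suc.prems(3) by (rule continuous_on_subset) (use w in auto)
    show "ennreal \<delta> \<le> L s t"
      if "i < k" "u \<le> s" "s \<le> t" "t \<le> w" "norm (\<gamma> s) \<le> B i" "B (Suc i) \<le> norm (\<gamma> t)"
      for i s t
      by (rule Suc.prems(6)[of i]) (use that w in auto)
  qed (use Suc.prems w in auto)
  moreover have "ennreal \<delta> \<le> L w v" by (rule Suc.prems(6)[of k]) (use Suc.prems w in auto)
  ultimately have "ennreal (real k * \<delta>) + ennreal \<delta> \<le> L u w + L w v" by (rule add_mono)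
  also have "\<dots> \<le> L u v"
    using Suc.prems(1) by (rule length_functional_add) (use w Suc.prems in auto)
  finally show ?case
    using Suc.prems(5) by (simp add: algebra_simps flip: ennreal_plus)
qed

text \<open>All balls of a shell share the radius \<open>r\<close>. Norms are compared through
  squares because the squared norm on a tangent ball is at most
  \<open>(norm p)\<^sup>2 + r\<^sup>2\<close>. The conditions on centres are those that tidiness
  needs inside one shell. The last condition admits every length functional, so that one barrier
  handles both notions of length.\<close>

definition shell_barrier :: "real \<Rightarrow> real \<Rightarrow> 'a::euclidean_space set \<Rightarrow> real \<Rightarrow> bool" where
  "shell_barrier a b C r \<longleftrightarrow> finite C \<and> 0 < r \<and>
    (\<forall>p\<in>C. a < norm p \<and> (norm p)\<^sup>2 + r\<^sup>2 < b\<^sup>2) \<and>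
    (\<forall>p\<in>C. \<forall>q\<in>C. p \<noteq> q \<longrightarrow> norm p = norm q \<longrightarrow> 2 * r < dist p q) \<and>
    (\<forall>p\<in>C. \<forall>q\<in>C. norm p < norm q \<longrightarrow> (norm p)\<^sup>2 + r\<^sup>2 < (norm q)\<^sup>2) \<and>
    (\<forall>\<gamma> L u v. length_functional {u..v} \<gamma> L \<longrightarrow> u \<le> v \<longrightarrow> continuous_on {u..v} \<gamma> \<longrightarrow>
      \<gamma> ` {u..v} \<inter> (\<Union>p\<in>C. tangent_ball p r) = {} \<longrightarrow>
      norm (\<gamma> u) \<le> a \<longrightarrow> b \<le> norm (\<gamma> v) \<longrightarrow> 1 \<le> L u v)"

text \<open>
  The layers of the shell have squared radii in arithmetic progression with difference \<open>2 r\<^sup>2\<close>, and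
  carry the colours of the net cyclically. A block of \<open>m\<close> consecutive layers has radial thickness of
  order \<open>r\<^sup>2\<close> but costs the path a length of at least \<open>r / 2\<close>.
\<close>

lemma shell_barrier_exists:
  fixes a b :: real
  assumes ab: "0 < a" "a < b" "b < 1"
  obtains C :: "'a::euclidean_space set" and r :: real where "shell_barrier a b C r"
proof -
  \<comment> \<open>For mesh \<open>r / 4\<close> the factor \<open>8 / a\<close> gives separation
    \<open>2 * r / a\<close> on the unit sphere, hence more than \<open>2 * r\<close> on spheres of
    radius above \<open>a\<close>. The factor depends on \<open>a\<close> only, so \<open>m\<close>
    is available before \<open>r\<close> is chosen.\<close>
  obtain m :: nat where m: "0 < m" and
    net: "\<forall>\<eta>>0. \<exists>P :: nat \<Rightarrow> 'a set.
        (\<forall>j. finite (P j) \<and> P j \<subseteq> sphere 0 1 \<and>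
          (\<forall>p\<in>P j. \<forall>q\<in>P j. p \<noteq> q \<longrightarrow> (8 / a) * \<eta> < dist p q)) \<and>
        (\<forall>u\<in>sphere 0 1. \<exists>j<m. \<exists>p\<in>P j. dist u p \<le> \<eta>)"
    using coloured_net[of "8 / a", where 'a = 'a] by blast
  \<comment> \<open>The bound 1 absorbs \<open>r\<^sup>2\<close> into \<open>r\<close>, the second
    bound keeps the radial displacement inside a block below \<open>r / 4\<close>, and the third
    lets all blocks fit under \<open>b\<close>.\<close>
  define r where "r = Min {1, a / (8 * (real m + 1)), (b\<^sup>2 - a\<^sup>2) / (6 * real m + 2)}"
  have ab2: "a\<^sup>2 < b\<^sup>2" using ab by (intro power_strict_mono) auto
  have r: "0 < r" using ab ab2 by (simp add: r_def)
  have r1: "r \<le> 1" and ra: "r \<le> a / (8 * (real m + 1))"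
    and rb: "r \<le> (b\<^sup>2 - a\<^sup>2) / (6 * real m + 2)"
    unfolding r_def by (rule Min_le; simp)+
  \<comment> \<open>The number of blocks: each costs \<open>r / 2\<close>, and the total has to
    reach 1.\<close>
  define N where "N = nat \<lceil>2 / r\<rceil>"
  have "real N = of_int \<lceil>2 / r\<rceil>" using r by (simp add: N_def)
  then have N: "2 / r \<le> real N" "real N \<le> 2 / r + 1" by linarith+
  \<comment> \<open>The blocks raise the squared radius by \<open>2 * m * N * r\<^sup>2\<close>,
    which is only of order \<open>r\<close> because \<open>N\<close> is about
    \<open>2 / r\<close>.\<close>
  have top: "a\<^sup>2 + (2 * real m * real N + 1) * r\<^sup>2 < b\<^sup>2"
  proof -
    have r2: "r\<^sup>2 \<le> r" using r r1 mult_left_le[of r r] by (simp add: power2_eq_square)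
    have "real N * r\<^sup>2 \<le> (2 / r + 1) * r\<^sup>2" using N by (intro mult_right_mono) auto
    also have "\<dots> = 2 * r + r\<^sup>2" using r by (simp add: field_simps power2_eq_square)
    also have "\<dots> \<le> 3 * r" using r2 by simp
    finally have "2 * real m * (real N * r\<^sup>2) \<le> 2 * real m * (3 * r)"
      by (intro mult_left_mono) auto
    then have "(2 * real m * real N + 1) * r\<^sup>2 \<le> (6 * real m + 1) * r"
      using r2 by (simp add: algebra_simps)
    also have "\<dots> < (6 * real m + 2) * r" using r by simp
    also have "\<dots> \<le> b\<^sup>2 - a\<^sup>2" using rb by (simp add: field_simps)
    finally show ?thesis by simp
  qed
  obtain P :: "nat \<Rightarrow> 'a set" where
    P: "\<And>j. finite (P j)" "\<And>j p. p \<in> P j \<Longrightarrow> norm p = 1"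
    and sep: "\<And>j p q. p \<in> P j \<Longrightarrow> q \<in> P j \<Longrightarrow> p \<noteq> q \<Longrightarrow> (8 / a) * (r / 4) < dist p q"
    and cover: "\<And>u. norm u = 1 \<Longrightarrow> \<exists>j<m. \<exists>p\<in>P j. dist u p \<le> r / 4"
  proof -
    have "0 < r / 4" using r by simp
    from net[rule_format, OF this] obtain P :: "nat \<Rightarrow> 'a set" where P:
      "(\<forall>j. finite (P j) \<and> P j \<subseteq> sphere 0 1 \<and>
          (\<forall>p\<in>P j. \<forall>q\<in>P j. p \<noteq> q \<longrightarrow> (8 / a) * (r / 4) < dist p q)) \<and>
        (\<forall>u\<in>sphere 0 1. \<exists>j<m. \<exists>p\<in>P j. dist u p \<le> r / 4)" ..
    show thesis
    proof (rule that[of P])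
      show "finite (P j)" for j using P by blast
      show "norm p = 1" if "p \<in> P j" for j p
        using conjunct1[OF P, THEN spec, of j] that by (auto simp: subset_iff)
      show "(8 / a) * (r / 4) < dist p q" if "p \<in> P j" "q \<in> P j" "p \<noteq> q" for j p q
        using conjunct1[OF P, THEN spec, of j] that by blast
      show "\<exists>j<m. \<exists>p\<in>P j. dist u p \<le> r / 4" if "norm u = 1" for u
        using conjunct2[OF P] that by simp
    qed
  qed
  \<comment> \<open>The radius of layer \<open>i\<close>. The shift by 1 puts layer 0 strictly above
    \<open>a\<close>; the gap of \<open>2 * r\<^sup>2\<close> exceeds the amount
    \<open>r\<^sup>2\<close> by which a ball can rise above its centre.\<close>
  define \<rho> where "\<rho> i = sqrt (a\<^sup>2 + 2 * (real i + 1) * r\<^sup>2)" for i :: nat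
  have rho2: "(\<rho> i)\<^sup>2 = a\<^sup>2 + 2 * (real i + 1) * r\<^sup>2" for i
    unfolding \<rho>_def using r ab by simp
  have rhoa: "a < \<rho> i" for i
    unfolding \<rho>_def using r ab by (intro real_less_rsqrt) simp
  have rho_less: "(\<rho> i)\<^sup>2 + r\<^sup>2 < (\<rho> j)\<^sup>2" if "i < j" for i j
  proof -
    have "real i + 1 \<le> real j" using that by linarith
    then have "(real i + 1) * r\<^sup>2 \<le> real j * r\<^sup>2" by (intro mult_right_mono) auto
    moreover have "0 < r\<^sup>2" using r by simp
    ultimately show ?thesis unfolding rho2 by (simp only: distrib_left distrib_right)
  qed
  have rho_mono: "i < j \<longleftrightarrow> \<rho> i < \<rho> j" for i j
    unfolding \<rho>_def using r by simp
  define C where "C = (\<Union>i<N * m. (\<lambda>p. \<rho> i *\<^sub>R p) ` P (i mod m))"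
  have CE: "\<exists>i<N * m. \<exists>q\<in>P (i mod m). p = \<rho> i *\<^sub>R q \<and> norm p = \<rho> i" if p: "p \<in> C" for p
  proof -
    obtain i q where "i < N * m" "q \<in> P (i mod m)" "p = \<rho> i *\<^sub>R q"
      using p unfolding C_def by blast
    moreover from this have "norm p = \<rho> i" using P(2)[of q] rhoa[of i] ab by simp
    ultimately show ?thesis by blast
  qed
  show ?thesis
  proof (rule that[of C r, unfolded shell_barrier_def], intro conjI allI ballI impI)
    show "finite C" unfolding C_def using P by auto
    show "0 < r" by (rule r)
    show "a < norm p" if "p \<in> C" for p using CE[OF that] rhoa by auto
    show "(norm p)\<^sup>2 + r\<^sup>2 < b\<^sup>2" if p: "p \<in> C" for p
    proof -
      obtain i where i: "i < N * m" "norm p = \<rho> i" using CE[OF p] by blast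
      then have "real i + 1 \<le> real (N * m)" by linarith
      then have "2 * (real i + 1) * r\<^sup>2 \<le> 2 * real (N * m) * r\<^sup>2"
        by (intro mult_right_mono) auto
      then show ?thesis using top i by (simp add: rho2 algebra_simps)
    qed
    show "2 * r < dist p q" if pq: "p \<in> C" "q \<in> C" "p \<noteq> q" "norm p = norm q" for p q
    proof -
      obtain i p' where p: "p' \<in> P (i mod m)" "p = \<rho> i *\<^sub>R p'" "norm p = \<rho> i"
        using CE[OF pq(1)] by blast
      obtain j q' where q: "q' \<in> P (j mod m)" "q = \<rho> j *\<^sub>R q'" "norm q = \<rho> j"
        using CE[OF pq(2)] by blast
      have "\<rho> i = \<rho> j" using pq(4) p(3) q(3) by simp
      then have "i = j" using rho_mono[of i j] rho_mono[of j i] by linarith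
      then have "p' \<noteq> q'" "q' \<in> P (i mod m)" using pq(3) p(2) q(1,2) by auto
      then have "2 * r / a < dist p' q'" using sep[OF p(1)] by fastforce
      then have "2 * r < a * dist p' q'" using ab by (simp add: field_simps)
      also have "\<dots> \<le> \<rho> i * dist p' q'" using rhoa[of i] by (intro mult_right_mono) auto
      also have "\<dots> = dist p q"
        using rhoa[of i] ab unfolding p(2) q(2) \<open>i = j\<close>
        by (simp add: dist_norm flip: scaleR_diff_right)
      finally show ?thesis .
    qed
    show "(norm p)\<^sup>2 + r\<^sup>2 < (norm q)\<^sup>2" if pq: "p \<in> C" "q \<in> C" "norm p < norm q" for p q
    proof -
      obtain i j where "norm p = \<rho> i" "norm q = \<rho> j"
        using CE[OF pq(1)] CE[OF pq(2)] by blast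
      then show ?thesis using rho_less[of i j] rho_mono[of i j] pq(3) by simp
    qed
  next
    fix \<gamma> :: "real \<Rightarrow> 'a" and L u v
    assume L: "length_functional {u..v} \<gamma> L" and uv: "u \<le> v"
      and cont: "continuous_on {u..v} \<gamma>"
      and avoid: "\<gamma> ` {u..v} \<inter> (\<Union>p\<in>C. tangent_ball p r) = {}"
      and ends: "norm (\<gamma> u) \<le> a" "b \<le> norm (\<gamma> v)"
    \<comment> \<open>The boundary between blocks: in squared radius it lies
      \<open>r\<^sup>2\<close> below layer \<open>k * m\<close> and \<open>r\<^sup>2\<close> above
      the layer preceding it. The balls of block \<open>k\<close> thus lie between the spheres of
      radii \<open>B k\<close> and \<open>B (Suc k)\<close>.\<close>
    define B where "B k = sqrt (a\<^sup>2 + (2 * real m * real k + 1) * r\<^sup>2)" for k :: nat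
    have B2: "(B k)\<^sup>2 = a\<^sup>2 + (2 * real m * real k + 1) * r\<^sup>2" for k
      unfolding B_def by simp
    have Ba: "a < B k" for k
      unfolding B_def using r by (intro real_less_rsqrt) (simp add: add_nonneg_pos)
    have B_mono: "B i \<le> B (Suc i)" for i
      unfolding B_def by (simp add: algebra_simps)
    have "ennreal (real N * (r / 2)) \<le> L u v"
    proof (rule level_crossing[OF L uv cont, where B = B])
      show "B i \<le> B (Suc i)" for i by (rule B_mono)
      show "0 \<le> r / 2" using r by simp
      show "norm (\<gamma> u) \<le> B 0" using ends Ba[of 0] by linarith
      show "B N \<le> norm (\<gamma> v)"
      proof -
        have "B N \<le> b" unfolding B_def using top ab by (intro real_le_lsqrt) auto
        then show ?thesis using ends by linarith
      qed
    next
      fix k s t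
      assume k: "k < N" and st: "u \<le> s" "s \<le> t" "t \<le> v"
        and lev: "norm (\<gamma> s) \<le> B k" "B (Suc k) \<le> norm (\<gamma> t)"
      have contst: "continuous_on {s..t} \<gamma>"
        using cont by (rule continuous_on_subset) (use st in auto)
      obtain w where w: "s \<le> w" "w \<le> t" "norm (\<gamma> w) = B k"
        using IVT'[of "\<lambda>t. norm (\<gamma> t)" s "B k" t] lev st B_mono[of k]
          continuous_on_norm[OF contst] by force
      have Bk: "0 < B k" using Ba[of k] ab by linarith
      \<comment> \<open>The detour is forced by the net point near the direction of the path at the
        moment \<open>w\<close> when it is on the inner sphere of the block. Its colour
        \<open>j\<close> is carried by layer \<open>k * m + j\<close> of the same block.\<close>
      obtain j p where j: "j < m" "p \<in> P j" "dist ((1 / B k) *\<^sub>R \<gamma> w) p \<le> r / 4"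
        using cover[of "(1 / B k) *\<^sub>R \<gamma> w"] w Bk by auto
      define i where "i = k * m + j"
      have "i < Suc k * m" using j by (simp add: i_def)
      also have "\<dots> \<le> N * m" using k by (intro mult_right_mono) auto
      finally have i: "i < N * m" "i mod m = j" using j by (auto simp: i_def)
      define c where "c = \<rho> i *\<^sub>R p"
      have cC: "c \<in> C" unfolding C_def c_def using i j by blast
      have nc: "norm c = \<rho> i" using P(2)[OF j(2)] rhoa[of i] ab by (simp add: c_def)
      have rB: "(B k)\<^sup>2 \<le> (\<rho> i)\<^sup>2" "(\<rho> i)\<^sup>2 + r\<^sup>2 \<le> (B (Suc k))\<^sup>2"
        "(\<rho> i)\<^sup>2 - (B k)\<^sup>2 \<le> 2 * (real m + 1) * r\<^sup>2"
      proof -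
        have e: "(\<rho> i)\<^sup>2 - (B k)\<^sup>2 = (2 * real j + 1) * r\<^sup>2"
          by (simp add: rho2 B2 i_def algebra_simps)
        have e': "(B (Suc k))\<^sup>2 - (\<rho> i)\<^sup>2 - r\<^sup>2 = 2 * (real m - (real j + 1)) * r\<^sup>2"
          by (simp add: rho2 B2 i_def algebra_simps)
        have jm: "real j + 1 \<le> real m" using j by linarith
        have "0 \<le> (2 * real j + 1) * r\<^sup>2" by simp
        then show "(B k)\<^sup>2 \<le> (\<rho> i)\<^sup>2" using e by linarith
        have "0 \<le> 2 * (real m - (real j + 1)) * r\<^sup>2" using jm by (intro mult_nonneg_nonneg) auto
        then show "(\<rho> i)\<^sup>2 + r\<^sup>2 \<le> (B (Suc k))\<^sup>2" using e' by linarith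
        show "(\<rho> i)\<^sup>2 - (B k)\<^sup>2 \<le> 2 * (real m + 1) * r\<^sup>2"
          unfolding e using jm by (intro mult_right_mono) auto
      qed
      have Brho: "B k \<le> \<rho> i"
        using rB(1) by (rule power2_le_imp_le) (use rhoa[of i] ab in simp)
      \<comment> \<open>One \<open>r / 4\<close> is the error of the net, scaled by
        \<open>B k \<le> 1\<close>. The other is the radial gap, obtained from the difference of
        squares through the factor \<open>\<rho> i + B k \<ge> a\<close>.\<close>
      have close: "dist (\<gamma> w) c \<le> r / 2"
      proof -
        have "dist (\<gamma> w) (B k *\<^sub>R p) = B k * dist ((1 / B k) *\<^sub>R \<gamma> w) p"
        proof -
          have "\<gamma> w - B k *\<^sub>R p = B k *\<^sub>R ((1 / B k) *\<^sub>R \<gamma> w - p)"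
            using Bk by (simp add: scaleR_diff_right)
          then show ?thesis using Bk by (simp add: dist_norm)
        qed
        also have "\<dots> \<le> 1 * (r / 4)"
        proof (intro mult_mono)
          have "(2 * real m * real k + 1) * r\<^sup>2 \<le> (2 * real m * real N + 1) * r\<^sup>2"
            using k by (intro mult_right_mono add_right_mono mult_left_mono) auto
          then have "(B k)\<^sup>2 \<le> b\<^sup>2" using top by (simp add: B2)
          then have "B k \<le> b" by (rule power2_le_imp_le) (use ab in simp)
          then show "B k \<le> 1" using ab by simp
        qed (use j in auto)
        finally have 1: "dist (\<gamma> w) (B k *\<^sub>R p) \<le> r / 4" by simp
        have "(\<rho> i - B k) * a \<le> (\<rho> i - B k) * (\<rho> i + B k)"
          using Brho Ba[of k] rhoa[of i] ab by (intro mult_left_mono) auto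
        also have "\<dots> = (\<rho> i)\<^sup>2 - (B k)\<^sup>2" by (simp add: algebra_simps power2_eq_square)
        also have "\<dots> \<le> 2 * (real m + 1) * r * r" using rB(3) by (simp add: power2_eq_square)
        also have "\<dots> \<le> (a / 4) * r"
          using ra r by (intro mult_right_mono) (auto simp: field_simps)
        finally have "(\<rho> i - B k) * a \<le> (r / 4) * a" by (simp add: mult.commute)
        then have 2: "\<rho> i - B k \<le> r / 4" using ab(1) by (rule mult_right_le_imp_le)
        have "dist (B k *\<^sub>R p) c = \<rho> i - B k"
          using P(2)[OF j(2)] Brho by (simp add: c_def dist_norm flip: scaleR_diff_left)
        then show ?thesis using 1 2 dist_triangle[of "\<gamma> w" c "B k *\<^sub>R p"] by linarith
      qed
      \<comment> \<open>From within \<open>r / 2\<close> of \<open>c\<close> the path must get to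
        distance \<open>r\<close>, which costs the block its length \<open>r / 2\<close>.\<close>
      have "\<exists>x\<in>{w..t}. r \<le> dist (\<gamma> x) c"
      proof (rule evade_tangent_ball)
        show "continuous_on {w..t} \<gamma>"
          using contst by (rule continuous_on_subset) (use w in auto)
        show "norm (\<gamma> w) \<le> norm c" using w Brho nc by simp
        have "(B (Suc k))\<^sup>2 \<le> (norm (\<gamma> t))\<^sup>2"
          using lev Ba[of "Suc k"] ab by (intro power_mono) auto
        then show "(norm c)\<^sup>2 + r\<^sup>2 \<le> (norm (\<gamma> t))\<^sup>2"
          using rB(2) unfolding nc by linarith
        show "\<gamma> ` {w..t} \<inter> tangent_ball c r = {}"
        proof -
          have "{w..t} \<subseteq> {u..v}" using st w by auto
          then show ?thesis using avoid cC by blast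
        qed
      qed (use w r in auto)
      then obtain x where x: "w \<le> x" "x \<le> t" "r \<le> dist (\<gamma> x) c" by auto
      have "r / 2 \<le> dist (\<gamma> w) (\<gamma> x)"
        using x close dist_triangle[of "\<gamma> x" c "\<gamma> w"] by (simp add: dist_commute)
      then have "ennreal (r / 2) \<le> ennreal (dist (\<gamma> w) (\<gamma> x))" by (rule ennreal_leI)
      also have "\<dots> \<le> L w x"
        using L by (rule length_functional_dist) (use st w x in auto)
      also have "\<dots> \<le> L w t"
        using L by (rule length_functional_mono) (use st w x in auto)
      also have "\<dots> \<le> L s w + L w t" by simp
      also have "\<dots> \<le> L s t"
        using L by (rule length_functional_add) (use st w x in auto)
      finally show "ennreal (r / 2) \<le> L s t" .
    qed
    moreover have "1 \<le> real N * (r / 2)" using N r by (simp add: field_simps)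
    then have "1 \<le> ennreal (real N * (r / 2))" by simp
    ultimately show "1 \<le> L u v" by (rule order_trans[rotated])
  qed
qed

section \<open>Polygonal and Riemannian length\<close>

lemma polygon_le_euclidean_length:
  assumes "mono_on {..m} s" "s ` {..m} \<subseteq> I"
  shows "(\<Sum>i<m. ennreal (dist (\<gamma> (s i)) (\<gamma> (s (Suc i))))) \<le> euclidean_length I \<gamma>"
  unfolding euclidean_length_def by (rule SUP_upper2[of "(m, s)"]) (use assms in auto)

lemma euclidean_length_mono:
  assumes "J \<subseteq> I"
  shows "euclidean_length J \<gamma> \<le> euclidean_length I \<gamma>"
  unfolding euclidean_length_def by (rule SUP_subset_mono) (use assms in auto)

text \<open>The vertices are listed one after the other. The polygons need not meet at parameter
  \<open>v\<close>, so the new polygon has one more edge, from \<open>s m\<close> to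
  \<open>s' 0\<close>; dropping it leaves an inequality.\<close>

lemma concat_polygons_le:
  fixes \<gamma> :: "real \<Rightarrow> 'a::euclidean_space"
  assumes s: "mono_on {..m} s" "s ` {..m} \<subseteq> {u..v}"
    and s': "mono_on {..m'} s'" "s' ` {..m'} \<subseteq> {v..w}" and uvw: "u \<le> v" "v \<le> w"
  shows "(\<Sum>i<m. ennreal (dist (\<gamma> (s i)) (\<gamma> (s (Suc i))))) +
      (\<Sum>i<m'. ennreal (dist (\<gamma> (s' i)) (\<gamma> (s' (Suc i))))) \<le> euclidean_length {u..w} \<gamma>"
proof -
  define t where "t i = (if i \<le> m then s i else s' (i - Suc m))" for i
  have sv: "u \<le> s i" "s i \<le> v" if "i \<le> m" for i
    using s(2) that by auto
  have s'v: "v \<le> s' i" "s' i \<le> w" if "i \<le> m'" for i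
    using s'(2) that by auto
  have "mono_on {..m + Suc m'} t"
  proof (rule mono_onI)
    fix i j assume ij: "i \<in> {..m + Suc m'}" "j \<in> {..m + Suc m'}" "i \<le> j"
    then consider "j \<le> m" | "i \<le> m" "m < j" | "m < i" by linarith
    then show "t i \<le> t j"
    proof cases
      case 1
      then show ?thesis using mono_onD[OF s(1), of i j] ij by (simp add: t_def)
    next
      case 2
      then have "s i \<le> v" "v \<le> s' (j - Suc m)" using sv[of i] s'v[of "j - Suc m"] ij by simp_all
      then show ?thesis using 2 by (simp add: t_def)
    next
      case 3
      then show ?thesis
        using mono_onD[OF s'(1), of "i - Suc m" "j - Suc m"] ij by (simp add: t_def)
    qed
  qed
  moreover have "t ` {..m + Suc m'} \<subseteq> {u..w}"
  proof (rule image_subsetI)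
    fix i assume "i \<in> {..m + Suc m'}"
    then have "i \<le> m \<or> i - Suc m \<le> m'" "i \<le> m + Suc m'" by auto
    then show "t i \<in> {u..w}"
      using order_trans[OF sv(2)[of i] uvw(2)] order_trans[OF uvw(1) s'v(1)[of "i - Suc m"]]
        sv(1)[of i] s'v(2)[of "i - Suc m"]
      by (cases "i \<le> m") (simp_all add: t_def)
  qed
  ultimately have le: "(\<Sum>i<m + Suc m'. ennreal (dist (\<gamma> (t i)) (\<gamma> (t (Suc i))))) \<le>
      euclidean_length {u..w} \<gamma>"
    by (rule polygon_le_euclidean_length)
  let ?f = "\<lambda>i. ennreal (dist (\<gamma> (t i)) (\<gamma> (t (Suc i))))"
  have "(\<Sum>i<m. ennreal (dist (\<gamma> (s i)) (\<gamma> (s (Suc i))))) = (\<Sum>i<m. ?f i)"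
    by (intro sum.cong) (auto simp: t_def)
  moreover have "(\<Sum>i<m'. ennreal (dist (\<gamma> (s' i)) (\<gamma> (s' (Suc i))))) = (\<Sum>i<m'. ?f (Suc m + i))"
    by (intro sum.cong) (auto simp: t_def)
  moreover have "(\<Sum>i<m. ?f i) + (\<Sum>i<m'. ?f (Suc m + i)) \<le> (\<Sum>i<m + Suc m'. ?f i)"
  proof -
    have "(\<Sum>i<m + Suc m'. ?f i) = (\<Sum>i<m. ?f i) + (\<Sum>i<Suc m'. ?f (m + i))"
      by (induction m') (simp_all add: add.assoc)
    also have "(\<Sum>i<Suc m'. ?f (m + i)) = ?f m + (\<Sum>i<m'. ?f (m + Suc i))"
      using sum.lessThan_Suc_shift[of "\<lambda>i. ?f (m + i)" m'] by simp
    finally show ?thesis by (simp add: add_left_mono)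
  qed
  ultimately show ?thesis using order_trans[OF _ le] by simp
qed

lemma length_functional_euclidean_length:
  fixes \<gamma> :: "real \<Rightarrow> 'a::euclidean_space"
  shows "length_functional I \<gamma> (\<lambda>u v. euclidean_length {u..v} \<gamma>)"
  unfolding length_functional_def
proof (intro conjI ballI impI)
  fix u v :: real assume "u \<le> v"
  then have "mono_on {..1} (\<lambda>i::nat. if i = 0 then u else v)"
    "(\<lambda>i::nat. if i = 0 then u else v) ` {..1} \<subseteq> {u..v}"
    by (auto simp: mono_on_def)
  from polygon_le_euclidean_length[OF this, of \<gamma>]
  show "ennreal (dist (\<gamma> u) (\<gamma> v)) \<le> euclidean_length {u..v} \<gamma>" by simp
next
  fix u v w :: real assume uvw: "u \<le> v \<and> v \<le> w"
  let ?A = "\<lambda>I. {(m::nat, s). mono_on {..m} s \<and> s ` {..m} \<subseteq> (I::real set)}"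
  let ?f = "\<lambda>(m, s). \<Sum>i<m. ennreal (dist (\<gamma> (s i)) (\<gamma> (s (Suc i))))"
  \<comment> \<open>Addition passes through a supremum in \<open>ennreal\<close> here only over a
    nonempty family; the polygon with a single vertex is a witness.\<close>
  have ne: "?A {a..b} \<noteq> {}" if "a \<le> b" for a b :: real
  proof -
    have "(0, \<lambda>_. a) \<in> ?A {a..b}" using that by (simp add: mono_on_def)
    then show ?thesis by blast
  qed
  have "euclidean_length {u..v} \<gamma> + euclidean_length {v..w} \<gamma> =
      (SUP y\<in>?A {v..w}. SUP x\<in>?A {u..v}. ?f x + ?f y)"
    unfolding euclidean_length_def using uvw
    by (simp only: ennreal_SUP_add_left[OF ne] ennreal_SUP_add_right[OF ne])
  also have "\<dots> \<le> euclidean_length {u..w} \<gamma>"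
    using concat_polygons_le[of _ _ u v _ _ w \<gamma>] uvw by (intro SUP_least) auto
  finally show "euclidean_length {u..v} \<gamma> + euclidean_length {v..w} \<gamma> \<le> euclidean_length {u..w} \<gamma>" .
qed

text \<open>Integrating the speed over parameter intervals gives a measure, hence additivity; the
  fundamental theorem of calculus bounds chords by integrals of the speed.\<close>

lemma length_functional_riemannian:
  fixes \<gamma> :: "real \<Rightarrow> 'a::euclidean_space"
  assumes "\<gamma> piecewise_C1_differentiable_on {0..1}"
  obtains L where "length_functional {0..1} \<gamma> L" "L 0 1 \<le> riemannian_length \<gamma>"
proof -
  obtain S D where cont: "continuous_on {0..1} \<gamma>" and S: "finite S"
    and D: "\<And>t. t \<in> {0..1} - S \<Longrightarrow> (\<gamma> has_vector_derivative D t) (at t)"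
    and contD: "continuous_on ({0..1} - S) D"
    using assms unfolding piecewise_C1_differentiable_on_def C1_differentiable_on_def by blast
  define E where "E = {0..1} - S"
  have [measurable]: "E \<in> sets borel"
    unfolding E_def by (rule sets.Diff[OF _ borel_closed[OF finite_imp_closed[OF S]]]) simp
  \<comment> \<open>Extension of the derivative by 0 makes it Borel measurable; the finitely many
    exceptional parameters do not change the integrals.\<close>
  define h where "h t = indicator E t *\<^sub>R D t" for t
  have [measurable]: "h \<in> borel_measurable borel"
    unfolding h_def using contD
    by (intro borel_measurable_continuous_on_indicator \<open>E \<in> sets borel\<close>) (simp add: E_def)
  \<comment> \<open>Half-open intervals make adjacent pieces disjoint, so that additivity of the
    measure applies directly.\<close>
  define L where "L u v = emeasure (density lborel (\<lambda>t. ennreal (norm (h t)))) {u<..v}" for u v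
  have L: "L u v = (\<integral>\<^sup>+t. ennreal (norm (h t)) * indicator {u<..v} t \<partial>lborel)" for u v
    unfolding L_def by (rule emeasure_density) auto
  show ?thesis
  proof (rule that[of L])
    show "length_functional {0..1} \<gamma> L"
      unfolding length_functional_def
    proof (intro conjI ballI impI)
      fix u v :: real assume uv: "u \<in> {0..1}" "v \<in> {0..1}" "u \<le> v"
      have Luv: "L u v = (\<integral>\<^sup>+t. ennreal (norm (indicator {u..v} t *\<^sub>R h t)) \<partial>lborel)"
        unfolding L using AE_lborel_singleton[of u]
        by (intro nn_integral_cong_AE) (auto elim!: eventually_mono split: split_indicator)
      show "ennreal (dist (\<gamma> u) (\<gamma> v)) \<le> L u v"
      proof (cases "L u v = \<infinity>")
        \<comment> \<open>The fundamental theorem yields a gauge integral. Finiteness of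
          \<open>L u v\<close> makes \<open>h\<close> Lebesgue integrable on the interval, and then
          both integrals agree.\<close>
        case False
        have "(D has_integral (\<gamma> v - \<gamma> u)) {u..v}"
          using S uv(3)
        proof (rule fundamental_theorem_of_calculus_interior_strong)
          show "(\<gamma> has_vector_derivative D t) (at t)" if "t \<in> {u<..<v} - S" for t
            using D that uv by auto
          show "continuous_on {u..v} \<gamma>"
            using cont by (rule continuous_on_subset) (use uv in auto)
        qed
        then have h: "(h has_integral (\<gamma> v - \<gamma> u)) {u..v}"
          by (rule has_integral_spike_finite[OF S, rotated]) (use uv in \<open>auto simp: h_def E_def\<close>)
        have "integrable lborel (\<lambda>t. indicator {u..v} t *\<^sub>R h t)"
          using False unfolding Luv by (intro integrableI_bounded) (auto simp: less_top)
        moreover from this have "(\<integral>t. indicator {u..v} t *\<^sub>R h t \<partial>lborel) = \<gamma> v - \<gamma> u"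
          using set_borel_integral_eq_integral(2)[of "{u..v}" h] integral_unique[OF h]
          by (simp add: set_integrable_def set_lebesgue_integral_def)
        ultimately have "ennreal (norm (\<gamma> v - \<gamma> u)) \<le> L u v"
          unfolding Luv using integral_norm_bound_ennreal by metis
        then show ?thesis by (simp add: dist_norm norm_minus_commute)
      qed simp
    next
      fix u v w :: real assume "u \<le> v \<and> v \<le> w"
      then have "{u<..w} = {u<..v} \<union> {v<..w}" by auto
      then show "L u v + L v w \<le> L u w"
        unfolding L_def by (subst plus_emeasure) auto
    qed
    have "norm (h t) \<le> norm (vector_derivative \<gamma> (at t))" for t
      using vector_derivative_at[OF D[of t]] by (auto simp: h_def E_def split: split_indicator)
    then show "L 0 1 \<le> riemannian_length \<gamma>"
      unfolding L riemannian_length_def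
      by (intro nn_integral_mono) (auto split: split_indicator intro: ennreal_leI)
  qed
qed

text \<open>No path is shorter than its chord. Hence Riemannian Cauchy sequences are Cauchy in the
  Euclidean sense, which supplies the candidate for the limit.\<close>

lemma dist_le_riemannian_dist: "ennreal (dist x y) \<le> riemannian_dist M x y"
  unfolding riemannian_dist_def
proof (rule INF_greatest, clarify)
  fix \<gamma> :: "real \<Rightarrow> 'a" assume "\<gamma> piecewise_C1_differentiable_on {0..1}"
  then obtain L where L: "length_functional {0..1} \<gamma> L" "L 0 1 \<le> riemannian_length \<gamma>"
    by (rule length_functional_riemannian)
  have "ennreal (dist (\<gamma> 0) (\<gamma> 1)) \<le> L 0 1"
    using L(1) by (rule length_functional_dist) auto
  with L(2) show "ennreal (dist (\<gamma> 0) (\<gamma> 1)) \<le> riemannian_length \<gamma>" by (rule order_trans[rotated])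
qed

section \<open>Completeness\<close>

text \<open>The points are joined to the limit by the preimages of segments in a flattening chart.\<close>

lemma riemannian_dist_tendsto_0:
  fixes \<sigma> :: "nat \<Rightarrow> 'a::euclidean_space"
  assumes M: "submanifold_of k W M" and x: "x \<in> M" and \<sigma>: "range \<sigma> \<subseteq> M" and lim: "\<sigma> \<longlonglongrightarrow> x"
  shows "(\<lambda>i. riemannian_dist M (\<sigma> i) x) \<longlonglongrightarrow> 0"
proof -
  obtain U V :: "'a set" and \<phi> \<psi> S where xU: "x \<in> U" and U: "open U" and V: "open V"
    and hom: "homeomorphism U V \<phi> \<psi>" and "C1_on V \<psi>" and S: "subspace S"
    and flat: "\<phi> ` (U \<inter> M) = V \<inter> S"
    using M x unfolding submanifold_of_def by metis
  then obtain \<psi>' where der: "\<And>y. y \<in> V \<Longrightarrow> (\<psi> has_derivative blinfun_apply (\<psi>' y)) (at y)"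
    and cont: "continuous_on V \<psi>'"
    unfolding C1_on_def by blast
  define q where "q = \<phi> x"
  have q: "q \<in> V \<inter> S" using flat xU x unfolding q_def by blast
  \<comment> \<open>On a compact ball around \<open>q\<close> inside \<open>V\<close> the derivative
    of \<open>\<psi>\<close> is bounded, so \<open>\<psi>\<close> stretches segments there by a
    bounded factor.\<close>
  obtain e where e: "0 < e" "cball q e \<subseteq> V" using V q open_contains_cball by blast
  have "compact (\<psi>' ` cball q e)"
    using cont e by (intro compact_continuous_image) (auto intro: continuous_on_subset)
  then obtain B where B: "0 < B" "\<And>y. y \<in> cball q e \<Longrightarrow> norm (\<psi>' y) \<le> B"
    using compact_imp_bounded bounded_pos by (metis image_eqI)
  have bound: "riemannian_dist M z x \<le> ennreal (B * dist (\<phi> z) q)"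
    if z: "z \<in> U \<inter> M" and zq: "\<phi> z \<in> cball q e" for z
  proof -
    define l where "l t = \<phi> z + t *\<^sub>R (q - \<phi> z)" for t :: real
    define D where "D t = blinfun_apply (\<psi>' (l t)) (q - \<phi> z)" for t
    have zS: "\<phi> z \<in> V \<inter> S" using flat z by blast
    have l: "l t \<in> cball q e" if "t \<in> {0..1}" for t
    proof -
      have "l t = (1 - t) *\<^sub>R \<phi> z + t *\<^sub>R q" by (simp add: l_def algebra_simps)
      then show ?thesis
        using convexD_alt[OF convex_cball[of q e] zq, of q t] e that by simp
    qed
    have lS: "l t \<in> S" for t
      unfolding l_def using S zS q by (auto intro!: subspace_add subspace_scale subspace_diff)
    have "(\<psi> \<circ> l has_vector_derivative D t) (at t)" if "t \<in> {0..1}" for t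
    proof -
      have "(l has_derivative (\<lambda>s. s *\<^sub>R (q - \<phi> z))) (at t)"
        unfolding l_def by (auto intro!: derivative_eq_intros)
      from has_derivative_compose[OF this der] l[OF that] e
      show ?thesis
        by (auto simp: has_vector_derivative_def o_def D_def blinfun.scaleR_right subset_iff)
    qed
    moreover have "continuous_on {0..1} D"
    proof -
      have "continuous_on {0..1} l" unfolding l_def by (intro continuous_intros)
      then have "continuous_on {0..1} (\<lambda>t. \<psi>' (l t))"
        using cont l e by (intro continuous_on_compose2[of V \<psi>' _ l]) auto
      then show ?thesis unfolding D_def by (intro continuous_intros)
    qed
    ultimately have C1: "\<psi> \<circ> l C1_differentiable_on {0..1}"
      and vd: "\<And>t. t \<in> {0..1} \<Longrightarrow> vector_derivative (\<psi> \<circ> l) (at t) = D t"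
      unfolding C1_differentiable_on_def by (blast intro: vector_derivative_at)+
    have "(\<psi> \<circ> l) ` {0..1} \<subseteq> M"
    proof
      fix w assume "w \<in> (\<psi> \<circ> l) ` {0..1}"
      then obtain t where t: "t \<in> {0..1}" "w = \<psi> (l t)" by auto
      then have "l t \<in> V \<inter> S" using l lS e by blast
      then obtain y where "y \<in> U \<inter> M" "l t = \<phi> y" using flat by blast
      then show "w \<in> M" using t hom by (simp add: homeomorphism_apply1)
    qed
    moreover have "(\<psi> \<circ> l) 0 = z" "(\<psi> \<circ> l) 1 = x"
      using z xU hom by (simp_all add: l_def q_def homeomorphism_apply1)
    ultimately have "riemannian_dist M z x \<le> riemannian_length (\<psi> \<circ> l)"
      unfolding riemannian_dist_def
      using C1_differentiable_imp_piecewise[OF C1] by (intro INF_lower) auto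
    also have "\<dots> \<le> (\<integral>\<^sup>+t\<in>{0..1::real}. ennreal (B * dist (\<phi> z) q) \<partial>lborel)"
      unfolding riemannian_length_def
    proof (intro nn_integral_mono)
      fix t :: real
      have "norm (D t) \<le> B * dist (\<phi> z) q" if "t \<in> {0..1}"
      proof -
        have "norm (D t) \<le> norm (\<psi>' (l t)) * norm (q - \<phi> z)"
          unfolding D_def by (rule norm_blinfun)
        also have "\<dots> \<le> B * norm (q - \<phi> z)"
          using B(2)[OF l[OF that]] by (rule mult_right_mono) simp
        finally show ?thesis by (simp add: dist_norm norm_minus_commute)
      qed
      then show "ennreal (norm (vector_derivative (\<psi> \<circ> l) (at t))) * indicator {0..1} t \<le>
          ennreal (B * dist (\<phi> z) q) * indicator {0..1} t"
        using vd[of t] by (auto split: split_indicator intro: ennreal_leI)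
    qed
    also have "\<dots> = ennreal (B * dist (\<phi> z) q)"
      by (simp add: nn_integral_cmult_indicator)
    finally show ?thesis .
  qed
  have "continuous_on U \<phi>" using hom by (simp add: homeomorphism_def)
  then have "isCont \<phi> x" using U xU by (simp add: continuous_on_eq_continuous_at)
  then have lim\<phi>: "(\<lambda>i. \<phi> (\<sigma> i)) \<longlonglongrightarrow> q"
    unfolding q_def using lim by (rule isCont_tendsto_compose)
  have "\<forall>\<^sub>F i in sequentially. \<sigma> i \<in> U" using lim U xU by (rule topological_tendstoD)
  moreover have "\<forall>\<^sub>F i in sequentially. dist (\<phi> (\<sigma> i)) q < e" using lim\<phi> e(1) by (rule tendstoD)
  ultimately have "\<forall>\<^sub>F i in sequentially.
      riemannian_dist M (\<sigma> i) x \<le> ennreal (B * dist (\<phi> (\<sigma> i)) q)"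
  proof eventually_elim
    case (elim i)
    moreover have "\<sigma> i \<in> M" using \<sigma> by blast
    ultimately show ?case using bound[of "\<sigma> i"] by (simp add: dist_commute)
  qed
  moreover have "(\<lambda>i. ennreal (B * dist (\<phi> (\<sigma> i)) q)) \<longlonglongrightarrow> ennreal (B * dist q q)"
    using lim\<phi> by (intro tendsto_ennrealI tendsto_intros)
  then have "(\<lambda>i. ennreal (B * dist (\<phi> (\<sigma> i)) q)) \<longlonglongrightarrow> 0" by simp
  ultimately show ?thesis
    using tendsto_sandwich[of "\<lambda>_. 0" "\<lambda>i. riemannian_dist M (\<sigma> i) x" sequentially] by simp
qed

text \<open>A Cauchy sequence has a Euclidean limit \<open>x\<close> in the closed unit ball. Were
  \<open>x\<close> on the sphere, late terms would be joined to a fixed term by paths in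
  \<open>M\<close> shorter than 1, against \<open>escape\<close>. So \<open>x\<close> is in the open
  ball, hence in the relatively closed set \<open>M\<close>, and a chart turns Euclidean convergence
  into Riemannian convergence.\<close>

lemma complete_closed_submanifold:
  fixes M :: "'a::euclidean_space set"
  assumes M: "closed_submanifold_of k (ball 0 1) M"
    and escape: "\<And>R. R < 1 \<Longrightarrow> \<exists>R'<1. \<forall>\<gamma>. \<gamma> piecewise_C1_differentiable_on {0..1} \<longrightarrow>
      \<gamma> ` {0..1} \<subseteq> M \<longrightarrow> norm (\<gamma> 0) \<le> R \<longrightarrow> R' \<le> norm (\<gamma> 1) \<longrightarrow> 1 \<le> riemannian_length \<gamma>"
  shows "complete_submanifold M"
  unfolding complete_submanifold_def
proof (intro allI impI, elim conjE)
  fix \<sigma> :: "nat \<Rightarrow> 'a"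
  assume \<sigma>: "range \<sigma> \<subseteq> M"
    and cauchy: "\<forall>\<epsilon>>0. \<exists>N. \<forall>i j. N \<le> i \<longrightarrow> N \<le> j \<longrightarrow> riemannian_dist M (\<sigma> i) (\<sigma> j) < \<epsilon>"
  have sub: "submanifold_of k (ball 0 1) M" and "closedin (top_of_set (ball 0 1)) M"
    using M by (auto simp: closed_submanifold_of_def)
  then obtain T where T: "closed T" "M = ball 0 1 \<inter> T" by (auto simp: closedin_closed)
  have "Cauchy \<sigma>"
    unfolding Cauchy_def
  proof (intro allI impI)
    fix e :: real assume "0 < e"
    then have "0 < ennreal e" by simp
    with cauchy obtain N where N:
      "\<And>i j. N \<le> i \<Longrightarrow> N \<le> j \<Longrightarrow> riemannian_dist M (\<sigma> i) (\<sigma> j) < ennreal e" by metis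
    have "dist (\<sigma> i) (\<sigma> j) < e" if "N \<le> i" "N \<le> j" for i j
      using le_less_trans[OF dist_le_riemannian_dist N[OF that]] by (simp add: ennreal_less_iff)
    then show "\<exists>N. \<forall>m\<ge>N. \<forall>n\<ge>N. dist (\<sigma> m) (\<sigma> n) < e" by blast
  qed
  then obtain x where x: "\<sigma> \<longlonglongrightarrow> x" using Cauchy_convergent convergent_def by blast
  have \<sigma>1: "norm (\<sigma> i) < 1" "\<sigma> i \<in> T" for i using \<sigma> T by (auto simp: image_subset_iff)
  have "norm x < 1"
  proof (rule ccontr)
    assume x1: "\<not> norm x < 1"
    obtain N where N: "\<And>i j. N \<le> i \<Longrightarrow> N \<le> j \<Longrightarrow> riemannian_dist M (\<sigma> i) (\<sigma> j) < 1"
      using cauchy zero_less_one by metis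
    obtain R' where R': "R' < 1"
      and long: "\<And>\<gamma>. \<gamma> piecewise_C1_differentiable_on {0..1} \<Longrightarrow> \<gamma> ` {0..1} \<subseteq> M \<Longrightarrow>
        norm (\<gamma> 0) \<le> norm (\<sigma> N) \<Longrightarrow> R' \<le> norm (\<gamma> 1) \<Longrightarrow> 1 \<le> riemannian_length \<gamma>"
      using escape[OF \<sigma>1(1)[of N]] by auto
    have "\<forall>\<^sub>F i in sequentially. R' < norm (\<sigma> i)"
      using x1 R' by (intro order_tendstoD(1)[OF tendsto_norm[OF x]]) simp
    then obtain j where j: "N \<le> j" "R' < norm (\<sigma> j)"
      unfolding eventually_sequentially by (meson nle_le)
    have "1 \<le> riemannian_dist M (\<sigma> N) (\<sigma> j)"
      unfolding riemannian_dist_def by (rule INF_greatest) (use long j in auto)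
    then show False using N[OF order_refl j(1)] by (simp add: not_le)
  qed
  moreover have "x \<in> T" using T(1) \<sigma>1(2) x by (rule closed_sequentially)
  ultimately have "x \<in> M" using T by simp
  then show "\<exists>x\<in>M. (\<lambda>i. riemannian_dist M (\<sigma> i) x) \<longlonglongrightarrow> 0"
    using riemannian_dist_tendsto_0[OF sub _ \<sigma> x] by blast
qed


section \<open>The tidy collection\<close>

text \<open>One barrier is placed in each shell between the radii \<open>a k\<close> and
  \<open>a (Suc k)\<close>. Inside a shell, tidiness is part of the barrier; balls of different
  shells are separated by the sphere between them.\<close>

lemma tidy_barrier_exists:
  assumes dim: "2 \<le> DIM('a::euclidean_space)" and lam: "0 < lam" "lam < 1"
  obtains F :: "'a::euclidean_space set set" and a :: "nat \<Rightarrow> real" where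
    "tidy F" "\<Union>F \<inter> cball 0 lam = {}" "incseq a" "\<And>k. a k < 1" "a \<longlonglongrightarrow> 1"
    "\<And>k \<gamma> L u v. length_functional {u..v} \<gamma> L \<Longrightarrow> u \<le> v \<Longrightarrow> continuous_on {u..v} \<gamma> \<Longrightarrow>
      \<gamma> ` {u..v} \<inter> \<Union>F = {} \<Longrightarrow> norm (\<gamma> u) \<le> a k \<Longrightarrow> a (Suc k) \<le> norm (\<gamma> v) \<Longrightarrow> 1 \<le> L u v"
proof -
  \<comment> \<open>Strictly increasing from \<open>lam\<close> to 1. As every ball stays above
    \<open>a 0 = lam\<close>, the closed ball of radius \<open>lam\<close> is missed.\<close>
  define a where "a k = 1 - (1 - lam) / real (Suc k)" for k
  have a0: "a 0 = lam" by (simp add: a_def)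
  have a_Suc: "a k < a (Suc k)" for k
    using lam unfolding a_def by (intro diff_strict_left_mono divide_strict_left_mono) auto
  have a1: "a k < 1" for k using lam by (simp add: a_def)
  have inc: "incseq a" using a_Suc by (intro incseq_SucI) (simp add: less_imp_le)
  have alam: "lam \<le> a k" for k using incseqD[OF inc, of 0 k] a0 by simp
  have a_lim: "a \<longlonglongrightarrow> 1"
  proof -
    have "(\<lambda>k. 1 - (1 - lam) * inverse (real (Suc k))) \<longlonglongrightarrow> 1 - (1 - lam) * 0"
      by (intro tendsto_intros LIMSEQ_inverse_real_of_nat)
    then show ?thesis by (simp add: a_def[abs_def] divide_inverse)
  qed
  have "\<exists>C r. shell_barrier (a k) (a (Suc k)) (C :: 'a set) r" for k
    using shell_barrier_exists[of "a k" "a (Suc k)"] a_Suc[of k] a1[of "Suc k"] alam[of k] lam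
    by (metis less_le_trans)
  then obtain C :: "nat \<Rightarrow> 'a set" and r where
    shell: "\<And>k. shell_barrier (a k) (a (Suc k)) (C k) (r k)" by metis
  note shell = shell[unfolded shell_barrier_def]
  have finC: "finite (C k)" and r: "0 < r k" for k using shell[of k] by blast+
  have lower: "a k < norm p" and upper: "(norm p)\<^sup>2 + (r k)\<^sup>2 < (a (Suc k))\<^sup>2"
    if "p \<in> C k" for k p using shell[of k] that by blast+
  have sep: "2 * r k < dist p q" if "p \<in> C k" "q \<in> C k" "p \<noteq> q" "norm p = norm q" for k p q
    using shell[of k] that by blast
  have layers: "(norm p)\<^sup>2 + (r k)\<^sup>2 < (norm q)\<^sup>2"
    if "p \<in> C k" "q \<in> C k" "norm p < norm q" for k p q
    using shell[of k] that by blast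
  have upper_j: "(norm p)\<^sup>2 + (r k)\<^sup>2 < (norm q)\<^sup>2" if "p \<in> C k" "q \<in> C j" "k < j" for p q k j
  proof -
    have "a (Suc k) \<le> a j" using inc that(3) by (simp add: incseqD)
    then have "a (Suc k) \<le> norm q" using lower[OF that(2)] by simp
    then have "(a (Suc k))\<^sup>2 \<le> (norm q)\<^sup>2"
      using alam[of "Suc k"] lam by (intro power_mono) auto
    then show ?thesis using upper[OF that(1)] by simp
  qed
  have less_j: "norm p < norm q" if "p \<in> C k" "q \<in> C j" "k < j" for p q k j
  proof -
    have "(norm p)\<^sup>2 < (norm q)\<^sup>2" using upper_j[OF that] zero_le_power2[of "r k"] by linarith
    then show ?thesis by (rule power2_less_imp_less) simp
  qed
  define F where "F = (\<Union>k. (\<lambda>p. tangent_ball p (r k)) ` C k)"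
  have p0: "p \<noteq> 0" if "p \<in> C k" for p k using lower[OF that] alam[of k] lam by auto
  \<comment> \<open>Tidiness quantifies over all centres and radii presenting a member of
    \<open>F\<close>; in dimension at least 2 these are the ones used in the construction.\<close>
  have Fdest: "\<exists>k. p \<in> C k \<and> s = r k" if F: "tangent_ball p s \<in> F" "0 < s" for p s
  proof -
    obtain k q where kq: "q \<in> C k" "tangent_ball p s = tangent_ball q (r k)"
      using F(1) unfolding F_def by blast
    then show ?thesis using tangent_ball_inject[OF dim F(2) r[of k] kq(2)] by blast
  qed
  show ?thesis
  proof (rule that[of F a])
    show "tidy F"
      unfolding tidy_def
    proof (intro conjI ballI allI impI; (elim conjE)?)
      fix T assume "T \<in> F"
      then obtain k p where p: "p \<in> C k" "T = tangent_ball p (r k)" unfolding F_def by blast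
      then show "\<exists>p r. p \<noteq> 0 \<and> 0 < r \<and> T = tangent_ball p r" using p0 r by blast
      have "(a (Suc k))\<^sup>2 < 1\<^sup>2"
        using a1[of "Suc k"] alam[of "Suc k"] lam by (intro power_strict_mono) auto
      then have "(norm p)\<^sup>2 + (r k)\<^sup>2 < 1\<^sup>2" using upper[OF p(1)] by linarith
      then show "T \<subseteq> ball 0 1" unfolding p(2) by (rule tangent_ball_subset_ball) simp
    next
      fix t :: real assume "t < 1"
      then have "\<forall>\<^sub>F k in sequentially. t < a k" using a_lim by (intro order_tendstoD)
      then obtain K where K: "\<And>k. K \<le> k \<Longrightarrow> t < a k" unfolding eventually_sequentially by blast
      \<comment> \<open>A ball of shell \<open>k\<close> stays outside radius \<open>a k\<close>, so
        only the finitely many shells with \<open>a k < t\<close> matter.\<close>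
      have "{T \<in> F. T \<inter> cball 0 t \<noteq> {}} \<subseteq> (\<Union>k<K. (\<lambda>p. tangent_ball p (r k)) ` C k)"
      proof
        fix T assume T: "T \<in> {T \<in> F. T \<inter> cball 0 t \<noteq> {}}"
        then obtain k p where kp: "p \<in> C k" "T = tangent_ball p (r k)"
          unfolding F_def by blast
        with T obtain x where x: "x \<in> tangent_ball p (r k)" "norm x \<le> t" by auto
        have "a k < t" using lower[OF kp(1)] tangent_ball_norm_ge[OF x(1)] x(2) by linarith
        then have "k < K" using K[of k] by (meson not_le order_less_asym)
        then show "T \<in> (\<Union>k<K. (\<lambda>p. tangent_ball p (r k)) ` C k)" using kp by blast
      qed
      then show "finite {T \<in> F. T \<inter> cball 0 t \<noteq> {}}"
        by (rule finite_subset) (use finC in auto)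
    next
      fix p1 p2 :: 'a and r1 r2
      assume r12: "0 < r1" "0 < r2" and F12: "tangent_ball p1 r1 \<in> F" "tangent_ball p2 r2 \<in> F"
      obtain k1 where 1: "p1 \<in> C k1" "r1 = r k1" using Fdest[OF F12(1) r12(1)] by blast
      obtain k2 where 2: "p2 \<in> C k2" "r2 = r k2" using Fdest[OF F12(2) r12(2)] by blast
      show "r1 = r2" and "tangent_ball p1 r1 \<inter> tangent_ball p2 r2 = {}"
        if ne: "tangent_ball p1 r1 \<noteq> tangent_ball p2 r2" and eq: "norm p1 = norm p2"
      proof -
        have "k1 = k2"
          using less_j[OF 1(1) 2(1)] less_j[OF 2(1) 1(1)] eq by (metis less_irrefl linorder_cases)
        then show "r1 = r2" using 1 2 by simp
        moreover from this have "p1 \<noteq> p2" using ne by auto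
        ultimately show "tangent_ball p1 r1 \<inter> tangent_ball p2 r2 = {}"
          using sep[of p1 k1 p2] 1 2 eq \<open>k1 = k2\<close> by (simp add: tangent_ball_disjoint)
      qed
      show "tangent_ball p1 r1 \<subseteq> ball 0 (norm p2)" if less: "norm p1 < norm p2"
      proof (rule tangent_ball_subset_ball)
        have "k1 \<le> k2" using less_j[OF 2(1) 1(1)] less by fastforce
        then show "(norm p1)\<^sup>2 + r1\<^sup>2 < (norm p2)\<^sup>2"
          using layers[of p1 k1 p2] upper_j[OF 1(1) 2(1)] 1 2 less by (cases "k1 = k2") auto
      qed simp
    qed
    show "\<Union>F \<inter> cball 0 lam = {}"
    proof (rule ccontr)
      assume "\<Union>F \<inter> cball 0 lam \<noteq> {}"
      then obtain k p x where "p \<in> C k" "x \<in> tangent_ball p (r k)" "norm x \<le> lam"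
        unfolding F_def by auto
      then show False using lower[of p k] tangent_ball_norm_ge[of x p "r k"] alam[of k] by linarith
    qed
    show "1 \<le> L u v"
      if "length_functional {u..v} \<gamma> L" "u \<le> v" "continuous_on {u..v} \<gamma>"
        "\<gamma> ` {u..v} \<inter> \<Union>F = {}" "norm (\<gamma> u) \<le> a k" "a (Suc k) \<le> norm (\<gamma> v)"
      for k \<gamma> L u v
    proof -
      have "\<gamma> ` {u..v} \<inter> (\<Union>p\<in>C k. tangent_ball p (r k)) = {}"
        using that(4) unfolding F_def by blast
      then show ?thesis using shell[of k] that by blast
    qed
  qed (use inc a1 a_lim in auto)
qed

section \<open>Infinite length of escaping paths and completeness of submanifolds\<close>

theorem theorem1p5:
  fixes n :: nat and lam0 :: real
  assumes "n \<ge> 1" and "CARD('m::finite) = n + 1"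
    and "0 < lam0" and "lam0 < 1"
  shows "\<exists>F :: (real ^ 'm) set set.
    tidy F \<and>
    \<Union>F \<inter> cball 0 lam0 = {} \<and>
    (\<forall>\<gamma> :: real \<Rightarrow> real ^ 'm.
        continuous_on {0..<1} \<gamma> \<and> \<gamma> ` {0..<1} \<subseteq> ball 0 1 \<and>
        ((\<lambda>t. norm (\<gamma> t)) \<longlongrightarrow> 1) (at_left 1) \<and>
        \<gamma> ` {0..<1} \<inter> \<Union>F = {} \<longrightarrow>
        euclidean_length {0..<1} \<gamma> = \<infinity>) \<and>
    (\<forall>k M. closed_submanifold_of k (ball 0 1) M \<and> M \<inter> \<Union>F = {} \<longrightarrow> complete_submanifold M)"
proof -
  have "2 \<le> DIM(real ^ 'm)" using assms by simp
  then obtain F :: "(real ^ 'm) set set" and a :: "nat \<Rightarrow> real" where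
    tidy: "tidy F" and miss: "\<Union>F \<inter> cball 0 lam0 = {}"
    and inc: "incseq a" and a1: "\<And>k. a k < 1" and a_lim: "a \<longlonglongrightarrow> 1"
    and barrier: "\<And>k \<gamma> L u v. length_functional {u..v} \<gamma> L \<Longrightarrow> u \<le> v \<Longrightarrow> continuous_on {u..v} \<gamma> \<Longrightarrow>
      \<gamma> ` {u..v} \<inter> \<Union>F = {} \<Longrightarrow> norm (\<gamma> u) \<le> a k \<Longrightarrow> a (Suc k) \<le> norm (\<gamma> v) \<Longrightarrow> 1 \<le> L u v"
    by (rule tidy_barrier_exists[OF _ assms(3,4)]) blast
  have above: "\<exists>k. R < a k" if "R < 1" for R
    using order_tendstoD(1)[OF a_lim that] by (auto simp: eventually_sequentially)
  have "euclidean_length {0..<1} \<gamma> = \<infinity>"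
    if cont: "continuous_on {0..<1} \<gamma>" and ball: "\<gamma> ` {0..<1} \<subseteq> ball 0 1"
      and lim: "((\<lambda>t. norm (\<gamma> t)) \<longlongrightarrow> 1) (at_left 1)" and avoid: "\<gamma> ` {0..<1} \<inter> \<Union>F = {}"
    for \<gamma> :: "real \<Rightarrow> real ^ 'm"
  proof -
    have "\<gamma> 0 \<in> ball 0 1" using ball by (simp add: image_subset_iff)
    then obtain k where k: "norm (\<gamma> 0) < a k" using above by auto
    \<comment> \<open>The path starts below \<open>a k\<close> and tends to the sphere, so it
      crosses the \<open>K\<close> shells up to \<open>a (k + K)\<close>, each at cost at least
      1.\<close>
    have long: "of_nat K \<le> euclidean_length {0..<1} \<gamma>" for K
    proof -
      have "\<forall>\<^sub>F t in at_left 1. a (k + K) < norm (\<gamma> t)" using lim a1 by (rule order_tendstoD)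
      moreover have "\<forall>\<^sub>F t in at_left (1::real). t \<in> {0<..<1}"
        by (rule eventually_at_left_real) simp
      ultimately have "\<forall>\<^sub>F t in at_left 1. a (k + K) < norm (\<gamma> t) \<and> t \<in> {0<..<1}"
        by (rule eventually_conj)
      then obtain v where v: "a (k + K) < norm (\<gamma> v)" "0 < v" "v < 1"
        using eventually_happens trivial_limit_at_left_real by fastforce
      have sub: "{s..t} \<subseteq> {0..<1}" if "0 \<le> s" "t \<le> v" for s t using that v by auto
      have "ennreal (real K * 1) \<le> euclidean_length {0..v} \<gamma>"
      proof (rule level_crossing[where B = "\<lambda>i. a (k + i)"])
        show "length_functional {0..v} \<gamma> (\<lambda>u v. euclidean_length {u..v} \<gamma>)"
          by (rule length_functional_euclidean_length)
        show "continuous_on {0..v} \<gamma>" using cont sub by (rule continuous_on_subset) auto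
        show "a (k + i) \<le> a (k + Suc i)" for i using inc by (simp add: incseqD)
        show "ennreal 1 \<le> euclidean_length {s..t} \<gamma>"
          if st: "0 \<le> s" "s \<le> t" "t \<le> v" and "norm (\<gamma> s) \<le> a (k + i)"
            "a (k + Suc i) \<le> norm (\<gamma> t)" for i s t
        proof -
          have "\<gamma> ` {s..t} \<inter> \<Union>F = {}" using avoid sub[OF st(1,3)] by blast
          moreover have "continuous_on {s..t} \<gamma>"
            using cont sub[OF st(1,3)] by (rule continuous_on_subset)
          ultimately show ?thesis
            using barrier[OF length_functional_euclidean_length st(2), of \<gamma> "k + i"] that by simp
        qed
      qed (use k v in auto)
      also have "\<dots> \<le> euclidean_length {0..<1} \<gamma>"
        by (rule euclidean_length_mono) (use sub in auto)
      finally show ?thesis by (simp add: ennreal_of_nat_eq_real_of_nat)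
    qed
    then show ?thesis
      using ennreal_Ex_less_of_nat[of "euclidean_length {0..<1} \<gamma>"]
      by (metis infinity_ennreal_def less_top not_less)
  qed
  moreover have "complete_submanifold M"
    if M: "closed_submanifold_of k (ball 0 1) M" and avoid: "M \<inter> \<Union>F = {}" for k M
    using M
  proof (rule complete_closed_submanifold)
    fix R :: real assume "R < 1"
    \<comment> \<open>The radius \<open>a (Suc k)\<close> serves as \<open>R'\<close>: a path in
      \<open>M\<close> from norm at most \<open>R\<close> to norm at least \<open>R'\<close> crosses
      the whole shell \<open>k\<close>.\<close>
    then obtain k where k: "R < a k" using above by blast
    have "1 \<le> riemannian_length \<gamma>"
      if \<gamma>: "\<gamma> piecewise_C1_differentiable_on {0..1}" "\<gamma> ` {0..1} \<subseteq> M"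
        "norm (\<gamma> 0) \<le> R" "a (Suc k) \<le> norm (\<gamma> 1)" for \<gamma>
    proof -
      obtain L where L: "length_functional {0..1} \<gamma> L" "L 0 1 \<le> riemannian_length \<gamma>"
        using \<gamma>(1) by (rule length_functional_riemannian)
      have "continuous_on {0..1} \<gamma>"
        using \<gamma>(1) by (simp add: piecewise_C1_differentiable_on_def)
      moreover have "\<gamma> ` {0..1} \<inter> \<Union>F = {}" using \<gamma>(2) avoid by blast
      ultimately have "1 \<le> L 0 1" using barrier[OF L(1), of k] \<gamma> k by simp
      then show ?thesis using L(2) by (rule order_trans)
    qed
    then show "\<exists>R'<1. \<forall>\<gamma>. \<gamma> piecewise_C1_differentiable_on {0..1} \<longrightarrow> \<gamma> ` {0..1} \<subseteq> M \<longrightarrow>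
        norm (\<gamma> 0) \<le> R \<longrightarrow> R' \<le> norm (\<gamma> 1) \<longrightarrow> 1 \<le> riemannian_length \<gamma>"
      using a1[of "Suc k"] by blast
  qed
  ultimately show ?thesis using tidy miss by blast
qed

end
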